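(* Let $(\phi,\gamma)$ be a lax action of a monoid $M$ on a monoid $A$. Then the product $$(m,a)(n,b)=(mn,\ \gamma_{m,n}\phi_n(a)b)$$ defines a monoid structure on the set $M\times A$.
   Context: A lax action of a monoid $M$ on a monoid $A$ is given by maps $\phi:A\times M\to A$, $(a,m)\mapsto\phi_m(a)$, and $\gamma:M\times M\to A$, $(m,n)\mapsto\gamma_{m,n}$, such that for all $a,b\in A$ and $m,n,k\in M$: (i) $\phi_1(a)=a$; (ii) $\gamma_{m,n}\phi_n(\phi_m(a))=\phi_{mn}(a)\gamma_{m,n}$; (iii) $\gamma_{mn,k}\phi_k(\gamma_{m,n})=\gamma_{m,nk}\gamma_{n,k}$; (iv) $\gamma_{1,m}=1=\gamma_{m,1}$; (v) $\phi_m(1)=1$ and $\phi_m(ab)=\phi_m(a)\phi_m(b)$. *)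

theory Defs
  imports "HOL-Algebra.Group"
begin

text \<open>
  We write \<open>\<phi> m a\<close> for $\phi_m(a)$ and \<open>\<gamma> m n\<close> for $\gamma_{m,n}$.
  The values of \<open>\<phi>\<close> and \<open>\<gamma>\<close> matter only on the carriers.
\<close>

locale lax_action = M: monoid M + A: monoid A
  for M :: "('m, 'x) monoid_scheme" and A :: "('a, 'y) monoid_scheme" +
  fixes \<phi> :: "'m \<Rightarrow> 'a \<Rightarrow> 'a" and \<gamma> :: "'m \<Rightarrow> 'm \<Rightarrow> 'a"
  assumes phi_closed: "\<lbrakk>m \<in> carrier M; a \<in> carrier A\<rbrakk> \<Longrightarrow> \<phi> m a \<in> carrier A"
    and gamma_closed: "\<lbrakk>m \<in> carrier M; n \<in> carrier M\<rbrakk> \<Longrightarrow> \<gamma> m n \<in> carrier A"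
    and phi_one_left: "a \<in> carrier A \<Longrightarrow> \<phi> \<one>\<^bsub>M\<^esub> a = a"
    and gamma_phi_phi: "\<lbrakk>a \<in> carrier A; m \<in> carrier M; n \<in> carrier M\<rbrakk>
      \<Longrightarrow> \<gamma> m n \<otimes>\<^bsub>A\<^esub> \<phi> n (\<phi> m a) = \<phi> (m \<otimes>\<^bsub>M\<^esub> n) a \<otimes>\<^bsub>A\<^esub> \<gamma> m n"
    and gamma_cocycle: "\<lbrakk>m \<in> carrier M; n \<in> carrier M; k \<in> carrier M\<rbrakk>
      \<Longrightarrow> \<gamma> (m \<otimes>\<^bsub>M\<^esub> n) k \<otimes>\<^bsub>A\<^esub> \<phi> k (\<gamma> m n) = \<gamma> m (n \<otimes>\<^bsub>M\<^esub> k) \<otimes>\<^bsub>A\<^esub> \<gamma> n k"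
    and gamma_one_left: "m \<in> carrier M \<Longrightarrow> \<gamma> \<one>\<^bsub>M\<^esub> m = \<one>\<^bsub>A\<^esub>"
    and gamma_one_right: "m \<in> carrier M \<Longrightarrow> \<gamma> m \<one>\<^bsub>M\<^esub> = \<one>\<^bsub>A\<^esub>"
    and phi_one: "m \<in> carrier M \<Longrightarrow> \<phi> m \<one>\<^bsub>A\<^esub> = \<one>\<^bsub>A\<^esub>"
    and phi_mult: "\<lbrakk>m \<in> carrier M; a \<in> carrier A; b \<in> carrier A\<rbrakk>
      \<Longrightarrow> \<phi> m (a \<otimes>\<^bsub>A\<^esub> b) = \<phi> m a \<otimes>\<^bsub>A\<^esub> \<phi> m b"

end

theory Submission
  imports Defs
begin

text \<open>
  The unit is \<open>(\<one>, \<one>)\<close>, by the normalisation of \<open>\<phi>\<close> and \<open>\<gamma>\<close>. For associativity, the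
  \<open>A\<close>-component of \<open>((m, a) (n, b)) (k, c)\<close> contains the factors
  \[ \gamma_{mn,k}\,\phi_k(\gamma_{m,n})\,\phi_k(\phi_n(a)) \]
  once \<open>\<phi> k\<close> has been distributed over the product. The cocycle identity turns the first two into
  $\gamma_{m,nk}\,\gamma_{n,k}$, which places $\gamma_{n,k}$ exactly where the lax functoriality of
  \<open>\<phi>\<close> can move it across $\phi_k(\phi_n(a))$. The result is
  $\gamma_{m,nk}\,\phi_{nk}(a)\,\gamma_{n,k}$, the corresponding part of
  \<open>(m, a) ((n, b) (k, c))\<close>. The factors \<open>\<phi> k b\<close> and \<open>c\<close> stay in place on the right.
\<close>

context lax_action
begin

text \<open>
  This is the part of associativity that involves the axioms for \<open>\<gamma>\<close>. It is the case \<open>b = c = 1\<close>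
  of the comparison of the two triple products, and multiplying it on the right by
  \<open>\<phi> k b\<close> and \<open>c\<close> gives the general case.
\<close>

lemma gamma_phi_twisted:
  assumes "m \<in> carrier M" "n \<in> carrier M" "k \<in> carrier M" "a \<in> carrier A"
  shows "\<gamma> (m \<otimes>\<^bsub>M\<^esub> n) k \<otimes>\<^bsub>A\<^esub> \<phi> k (\<gamma> m n \<otimes>\<^bsub>A\<^esub> \<phi> n a)
    = \<gamma> m (n \<otimes>\<^bsub>M\<^esub> k) \<otimes>\<^bsub>A\<^esub> \<phi> (n \<otimes>\<^bsub>M\<^esub> k) a \<otimes>\<^bsub>A\<^esub> \<gamma> n k"
proof -
  note closed = assms phi_closed gamma_closed M.m_closed A.m_closed
  have "\<gamma> (m \<otimes>\<^bsub>M\<^esub> n) k \<otimes>\<^bsub>A\<^esub> \<phi> k (\<gamma> m n \<otimes>\<^bsub>A\<^esub> \<phi> n a)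
      = (\<gamma> (m \<otimes>\<^bsub>M\<^esub> n) k \<otimes>\<^bsub>A\<^esub> \<phi> k (\<gamma> m n)) \<otimes>\<^bsub>A\<^esub> \<phi> k (\<phi> n a)"
    by (simp add: closed phi_mult A.m_assoc)
  also have "\<dots> = \<gamma> m (n \<otimes>\<^bsub>M\<^esub> k) \<otimes>\<^bsub>A\<^esub> (\<gamma> n k \<otimes>\<^bsub>A\<^esub> \<phi> k (\<phi> n a))"
    by (simp add: closed gamma_cocycle A.m_assoc)
  also have "\<dots> = \<gamma> m (n \<otimes>\<^bsub>M\<^esub> k) \<otimes>\<^bsub>A\<^esub> \<phi> (n \<otimes>\<^bsub>M\<^esub> k) a \<otimes>\<^bsub>A\<^esub> \<gamma> n k"
    by (simp add: closed gamma_phi_phi A.m_assoc)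
  finally show ?thesis .
qed

lemma crossed_product_assoc:
  assumes "m \<in> carrier M" "n \<in> carrier M" "k \<in> carrier M"
    and "a \<in> carrier A" "b \<in> carrier A" "c \<in> carrier A"
  shows "\<gamma> (m \<otimes>\<^bsub>M\<^esub> n) k \<otimes>\<^bsub>A\<^esub> \<phi> k (\<gamma> m n \<otimes>\<^bsub>A\<^esub> \<phi> n a \<otimes>\<^bsub>A\<^esub> b) \<otimes>\<^bsub>A\<^esub> c
    = \<gamma> m (n \<otimes>\<^bsub>M\<^esub> k) \<otimes>\<^bsub>A\<^esub> \<phi> (n \<otimes>\<^bsub>M\<^esub> k) a \<otimes>\<^bsub>A\<^esub> (\<gamma> n k \<otimes>\<^bsub>A\<^esub> \<phi> k b \<otimes>\<^bsub>A\<^esub> c)"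
proof -
  note closed = assms phi_closed gamma_closed M.m_closed A.m_closed
  have "\<gamma> (m \<otimes>\<^bsub>M\<^esub> n) k \<otimes>\<^bsub>A\<^esub> \<phi> k (\<gamma> m n \<otimes>\<^bsub>A\<^esub> \<phi> n a \<otimes>\<^bsub>A\<^esub> b) \<otimes>\<^bsub>A\<^esub> c
      = (\<gamma> (m \<otimes>\<^bsub>M\<^esub> n) k \<otimes>\<^bsub>A\<^esub> \<phi> k (\<gamma> m n \<otimes>\<^bsub>A\<^esub> \<phi> n a)) \<otimes>\<^bsub>A\<^esub> \<phi> k b \<otimes>\<^bsub>A\<^esub> c"
    by (simp add: closed phi_mult A.m_assoc)
  also have "\<dots> = \<gamma> m (n \<otimes>\<^bsub>M\<^esub> k) \<otimes>\<^bsub>A\<^esub> \<phi> (n \<otimes>\<^bsub>M\<^esub> k) a \<otimes>\<^bsub>A\<^esub> (\<gamma> n k \<otimes>\<^bsub>A\<^esub> \<phi> k b \<otimes>\<^bsub>A\<^esub> c)"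
    unfolding gamma_phi_twisted[OF assms(1-4)] by (simp add: closed A.m_assoc)
  finally show ?thesis .
qed

end

theorem lemma4p1:
  fixes M :: "('m, 'x) monoid_scheme" and A :: "('a, 'y) monoid_scheme"
    and \<phi> :: "'m \<Rightarrow> 'a \<Rightarrow> 'a" and \<gamma> :: "'m \<Rightarrow> 'm \<Rightarrow> 'a"
  assumes "lax_action M A \<phi> \<gamma>"
  shows "\<exists>e. monoid \<lparr>carrier = carrier M \<times> carrier A,
    mult = (\<lambda>(m, a) (n, b). (m \<otimes>\<^bsub>M\<^esub> n, (\<gamma> m n \<otimes>\<^bsub>A\<^esub> \<phi> n a) \<otimes>\<^bsub>A\<^esub> b)),
    one = e\<rparr>"
proof -
  interpret lax_action M A \<phi> \<gamma> by fact
  show ?thesis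
    by (rule exI[of _ "(\<one>\<^bsub>M\<^esub>, \<one>\<^bsub>A\<^esub>)"], rule monoidI)
      (auto simp: phi_closed gamma_closed M.m_assoc crossed_product_assoc
        phi_one_left phi_one gamma_one_left gamma_one_right)
qed

end
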